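(* Let $(X_t)_{t\in\mathbb{Z}}$ be a stationary stochastic process with values in a countable set $\mathcal{O}$, with space of future distributions $\mathcal{G}$ and observable operators $t_a:\mathcal{G}\to\mathcal{G}$, $a\in\mathcal{O}$. Suppose that for all $\bar c\in\mathcal{O}^{*}$ and $\mu_\epsilon$-almost all $\tilde a\in F$ the limit $$\lim_{k\to\infty}\frac{g_{\bar c}(\tilde a^{k})}{g_{\epsilon}(\tilde a^{k})}$$ exists. Then for every $a\in\mathcal{O}$ the observable operator $t_a$ is continuous with respect to the norm $\|g\|=\sqrt{\langle g,g\rangle}$ induced by the inner product $\langle g_1,g_2\rangle=\langle\phi(g_1),\phi(g_2)\rangle_{L^2(\mu_\epsilon)}$ on $\mathcal{G}$. Additionally, its operator norm satisfies $\|t_a\|\le 1$.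
   Context: Let $\mathcal{O}$ be a (nonempty) countable set and let $(X_t)_{t\in\mathbb{Z}}$ be a stationary stochastic process with values in $\mathcal{O}$, i.e. $\mathbb{P}(X_{t_1}=x_1,\dots,X_{t_k}=x_k)=\mathbb{P}(X_{t_1+l}=x_1,\dots,X_{t_k+l}=x_k)$ for all times $t_1,\dots,t_k\in\mathbb{Z}$, all $x_i\in\mathcal{O}$ and all $l\in\mathbb{Z}$. Let $\mathcal{O}^{+}=\bigcup_{i\ge 1}\mathcal{O}^i$ and $\mathcal{O}^{*}=\mathcal{O}^{+}\cup\{\epsilon\}$, where $\epsilon$ is the empty string. For $\bar a=x_1\cdots x_k\in\mathcal{O}^k$ write $\mathbb{P}(\bar a)=\mathbb{P}(X_{1}=x_1,\dots,X_{k}=x_k)$, and $\mathbb{P}(\epsilon)=1$. Concatenation of strings is written $\bar a\bar b$, and $\mathbb{P}(\bar b\mid\bar a)=\mathbb{P}(\bar a\bar b)/\mathbb{P}(\bar a)$ if $\mathbb{P}(\bar a)\neq 0$. For each $\bar a\in\mathcal{O}^{*}$ define $g_{\bar a}:\mathcal{O}^{*}\to\mathbb{R}$ by $g_{\bar a}(\bar b)=\mathbb{P}(\bar b\mid\bar a)$ if $\mathbb{P}(\bar a)\neq 0$ (so $g_{\bar a}(\epsilon)=1$), and $g_{\bar a}\equiv 0$ if $\mathbb{P}(\bar a)=0$. The space of future distributions $\mathcal{G}$ is the real vector space of all finite linear combinations of the functions $g_{\bar a}$, $\bar a\in\mathcal{O}^{*}$. Fix $\Lambda\subseteq\mathcal{O}^{*}$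 such that $(g_{\bar a})_{\bar a\in\Lambda}$ is a Hamel basis of $\mathcal{G}$ (so $\mathbb{P}(\bar a)\ne0$ for $\bar a\in\Lambda$). For $a\in\mathcal{O}$ the observable operator $t_a:\mathcal{G}\to\mathcal{G}$ is the linear map with $t_a(g_{\bar c})=\mathbb{P}(a\mid\bar c)\,g_{\bar c a}$ for $\bar c\in\Lambda$; it does not depend on the choice of $\Lambda$. Let $F$ be the set of all right-infinite sequences of elements of $\mathcal{O}$; for $\tilde a=x_1x_2\cdots\in F$ write $\tilde a^k=x_1\cdots x_k$. For $\bar b\in\mathcal{O}^k$, $k\ge1$, let $E(\bar b)=\{\tilde a\in F:\tilde a^k=\bar b\}$. Let $\mathcal{E}=\bigcup_{k=1}^\infty\{\bigcup_{\bar b\in K}E(\bar b): K\subseteq\mathcal{O}^k\}$, an algebra of subsets of $F$, and let $\sigma(\mathcal{E})$ be the $\sigma$-algebra it generates. For $\bar a\in\mathcal{O}^{*}$, $\mu_{\bar a}$ is the unique finite measure on $\sigma(\mathcal{E})$ with $\mu_{\bar a}(\bigcup_{\bar b\in K}E(\bar b))=\sum_{\bar b\in K}g_{\bar a}(\bar b)$ for all $k\ge1$, $K\subseteq\mathcal{O}^k$. Each $\mu_{\bar a}$ has a density $\gamma(g_{\bar a})$ with respect to $\mu_\epsilon$ (the Radon–Nikodym derivative, unique up to $\mu_\epsilon$-null sets): $\mu_{\bar a}(A)=\int_A\gamma(g_{\bar a})\,d\mu_\epsilon$ for all $A\in\sigma(\mathcal{E})$, and its class $[\gamma(g_{\bar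 a})]$ lies in the real space $L^2(\mu_\epsilon)$. The map $\phi:\mathcal{G}\to L^2(\mu_\epsilon)$ is the linear map with $\phi(g_{\bar a})=[\gamma(g_{\bar a})]$ for $\bar a\in\Lambda$; it is injective and does not depend on the choice of $\Lambda$. *)

theory Defs
  imports
    "HOL-Analysis.Analysis"
    "HOL-Probability.Probability"
    "HOL-Library.Function_Algebras"
    "HOL-Library.Stream"
begin

text \<open>Real-valued functions form a real vector space under the pointwise operations
  (the additive structure comes from \<^theory>\<open>HOL-Library.Function_Algebras\<close>); this makes
  \<^const>\<open>span\<close>, \<^const>\<open>independent\<close> and \<^const>\<open>construct\<close> available for spaces of functions.\<close>

instantiation "fun" :: (type, real_vector) real_vector
begin

definition scaleR_fun :: "real \<Rightarrow> ('a \<Rightarrow> 'b) \<Rightarrow> 'a \<Rightarrow> 'b"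
  where "scaleR_fun r f = (\<lambda>x. r *\<^sub>R f x)"

instance
  by standard (auto simp: scaleR_fun_def fun_eq_iff scaleR_add_left scaleR_add_right)

end


section \<open>Stationary processes and future distributions\<close>

text \<open>The countable alphabet is a type of class \<^class>\<open>countable\<close>, with the discrete
  \<open>\<sigma>\<close>-algebra. Finite strings are lists, right-infinite sequences are streams, and the
  prefix \<open>\<tilde>a\<^sup>k\<close> of a sequence \<open>s\<close> is \<open>stake k s\<close>.\<close>

definition stationary_process :: "'w measure \<Rightarrow> (int \<Rightarrow> 'w \<Rightarrow> 'o::countable) \<Rightarrow> bool"
  where "stationary_process M X \<longleftrightarrow>
    prob_space M \<and>
    (\<forall>t. X t \<in> measurable M (count_space UNIV)) \<and>
    (\<forall>ts xs l. length ts = length xs \<longrightarrow>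
       measure M {w \<in> space M. \<forall>i<length xs. X (ts ! i) w = xs ! i} =
       measure M {w \<in> space M. \<forall>i<length xs. X (ts ! i + l) w = xs ! i})"

definition word_prob :: "'w measure \<Rightarrow> (int \<Rightarrow> 'w \<Rightarrow> 'o::countable) \<Rightarrow> 'o list \<Rightarrow> real"
  where "word_prob M X xs = measure M {w \<in> space M. \<forall>i<length xs. X (int i + 1) w = xs ! i}"

definition future_fun ::
    "'w measure \<Rightarrow> (int \<Rightarrow> 'w \<Rightarrow> 'o::countable) \<Rightarrow> 'o list \<Rightarrow> 'o list \<Rightarrow> real"
  where "future_fun M X a =
    (\<lambda>b. if word_prob M X a \<noteq> 0 then word_prob M X (a @ b) / word_prob M X a else 0)"

definition future_space ::
    "'w measure \<Rightarrow> (int \<Rightarrow> 'w \<Rightarrow> 'o::countable) \<Rightarrow> ('o list \<Rightarrow> real) set"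
  where "future_space M X = span (range (future_fun M X))"

text \<open>The indexed family \<open>(g\<^sub>a)\<close>, \<open>a \<in> L\<close>, is a Hamel basis; hence the injectivity requirement.\<close>

definition future_basis ::
    "'w measure \<Rightarrow> (int \<Rightarrow> 'w \<Rightarrow> 'o::countable) \<Rightarrow> 'o list set \<Rightarrow> bool"
  where "future_basis M X L \<longleftrightarrow>
    inj_on (future_fun M X) L \<and>
    independent (future_fun M X ` L) \<and>
    span (future_fun M X ` L) = future_space M X"

text \<open>Linear extension of the assignment \<open>g\<^sub>c \<mapsto> v c\<close>, \<open>c \<in> L\<close>. The library's
  \<^const>\<open>construct\<close> yields a linear map on all functions; only its values on
  \<open>future_space M X\<close>, which are determined by \<open>v\<close> when \<open>L\<close> is a basis, are meaningful.\<close>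

definition future_extend ::
    "'w measure \<Rightarrow> (int \<Rightarrow> 'w \<Rightarrow> 'o::countable) \<Rightarrow> 'o list set \<Rightarrow>
     ('o list \<Rightarrow> 'v::real_vector) \<Rightarrow> ('o list \<Rightarrow> real) \<Rightarrow> 'v"
  where "future_extend M X L v =
    construct (future_fun M X ` L) (\<lambda>f. v (inv_into L (future_fun M X) f))"

text \<open>For \<open>c \<in> L\<close> we have \<open>P(c) \<noteq> 0\<close>, so \<open>P(a | c) = g\<^sub>c(a)\<close>.\<close>

definition observable_op ::
    "'w measure \<Rightarrow> (int \<Rightarrow> 'w \<Rightarrow> 'o::countable) \<Rightarrow> 'o list set \<Rightarrow> 'o \<Rightarrow>
     ('o list \<Rightarrow> real) \<Rightarrow> ('o list \<Rightarrow> real)"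
  where "observable_op M X L a =
    future_extend M X L (\<lambda>c. future_fun M X c [a] *\<^sub>R future_fun M X (c @ [a]))"


section \<open>Measures on infinite sequences\<close>

definition cyl :: "'o list \<Rightarrow> 'o stream set"
  where "cyl b = {s. stake (length b) s = b}"

definition cyl_algebra :: "'o stream set set"
  where "cyl_algebra = (\<Union>k\<in>{1..}. {(\<Union>b\<in>K. cyl b) | K. K \<subseteq> {b. length b = k}})"

definition future_measure ::
    "'w measure \<Rightarrow> (int \<Rightarrow> 'w \<Rightarrow> 'o::countable) \<Rightarrow> 'o list \<Rightarrow> 'o stream measure"
  where "future_measure M X a = (THE N.
    finite_measure N \<and> space N = UNIV \<and> sets N = sigma_sets UNIV cyl_algebra \<and>
    (\<forall>k\<ge>1. \<forall>K\<subseteq>{b. length b = k}.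
       measure N (\<Union>b\<in>K. cyl b) = (\<Sum>\<^sub>\<infinity>b\<in>K. future_fun M X a b)))"

definition future_density ::
    "'w measure \<Rightarrow> (int \<Rightarrow> 'w \<Rightarrow> 'o::countable) \<Rightarrow> 'o list \<Rightarrow> 'o stream \<Rightarrow> real"
  where "future_density M X a =
    (\<lambda>s. enn2real (RN_deriv (future_measure M X []) (future_measure M X a) s))"


section \<open>Inner product, norm and operator norm on the space of future distributions\<close>

text \<open>Elements of \<open>L\<^sup>2(\<mu>\<^sub>\<epsilon>)\<close> are handled through representatives: \<open>future_embed M X L g\<close> is a
  square-integrable function whose class modulo \<open>\<mu>\<^sub>\<epsilon>\<close>-null sets is \<open>\<phi>(g)\<close>. The inner product
  below does not depend on the representatives.\<close>

definition future_embed ::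
    "'w measure \<Rightarrow> (int \<Rightarrow> 'w \<Rightarrow> 'o::countable) \<Rightarrow> 'o list set \<Rightarrow>
     ('o list \<Rightarrow> real) \<Rightarrow> 'o stream \<Rightarrow> real"
  where "future_embed M X L = future_extend M X L (future_density M X)"

definition future_inner ::
    "'w measure \<Rightarrow> (int \<Rightarrow> 'w \<Rightarrow> 'o::countable) \<Rightarrow> 'o list set \<Rightarrow>
     ('o list \<Rightarrow> real) \<Rightarrow> ('o list \<Rightarrow> real) \<Rightarrow> real"
  where "future_inner M X L g h =
    (\<integral>s. future_embed M X L g s * future_embed M X L h s \<partial>(future_measure M X []))"

definition future_norm ::
    "'w measure \<Rightarrow> (int \<Rightarrow> 'w \<Rightarrow> 'o::countable) \<Rightarrow> 'o list set \<Rightarrow> ('o list \<Rightarrow> real) \<Rightarrow> real"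
  where "future_norm M X L g = sqrt (future_inner M X L g g)"

definition future_topology ::
    "'w measure \<Rightarrow> (int \<Rightarrow> 'w \<Rightarrow> 'o::countable) \<Rightarrow> 'o list set \<Rightarrow> ('o list \<Rightarrow> real) topology"
  where "future_topology M X L =
    Metric_space.mtopology (future_space M X) (\<lambda>g h. future_norm M X L (g - h))"

text \<open>Relative to a subspace \<open>V\<close> with norm \<open>N\<close>; as in \<^const>\<open>onorm\<close>, the quotient at the zero
  vector is \<open>0 / 0 = 0\<close>. The supremum is taken in \<^typ>\<open>ereal\<close>, so an unbounded operator has
  norm \<open>\<infinity>\<close>.\<close>

definition onorm_on :: "'v set \<Rightarrow> ('v \<Rightarrow> real) \<Rightarrow> ('v \<Rightarrow> 'v) \<Rightarrow> ereal"
  where "onorm_on V N t = (SUP v\<in>V. ereal (N (t v) / N v))"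

end

theory Submission
  imports Defs
begin

text \<open>
  For every letter \<open>a\<close> and every \<open>g\<close> in the space of future distributions,
  \<open>\<parallel>t\<^sub>a g\<parallel> \<le> \<parallel>g\<parallel>\<close>; continuity and the bound on the operator norm follow. The idea is to
  describe \<open>t\<^sub>a\<close> on densities.

  The operator acts by \<open>(t\<^sub>a g)(b) = g(ab)\<close>. Let \<open>f\<close> be the density of \<open>g\<close> with respect to
  \<open>\<mu>\<^sub>\<epsilon>\<close>, so that \<open>g(b)\<close> is the integral of \<open>f\<close> over the cylinder of \<open>b\<close>, and let \<open>w\<close> be the density
  of \<open>P(a) \<mu>\<^sub>a\<close>, the image of \<open>\<mu>\<^sub>\<epsilon>\<close> restricted to the sequences starting with \<open>a\<close> under removal
  of the first letter. By change of variables, \<open>t\<^sub>a g\<close> has the density \<open>s \<mapsto> w(s) f(as)\<close>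
  (\<open>represents_SCons\<close>). By stationarity \<open>P(a) \<mu>\<^sub>a \<le> \<mu>\<^sub>\<epsilon>\<close> (\<open>emeasure_joint_measure_le\<close>), hence
  \<open>0 \<le> w \<le> 1\<close> almost everywhere. Therefore (\<open>integral_square_SCons_le\<close>)
  \<open>\<integral> (w(s) f(as))\<^sup>2 d\<mu>\<^sub>\<epsilon> \<le> \<integral> w(s) f(as)\<^sup>2 d\<mu>\<^sub>\<epsilon> = \<integral> f\<^sup>2 1{s\<^sub>1 = a} d\<mu>\<^sub>\<epsilon> \<le> \<integral> f\<^sup>2 d\<mu>\<^sub>\<epsilon>\<close>.

  The embedding is defined through a Hamel basis, whereas the formula for the density of
  \<open>t\<^sub>a g\<close> is not. They are matched by the uniqueness of densities with given integrals over
  cylinders (\<open>represents_unique\<close>); the same principle identifies the measures \<open>\<mu>\<^sub>a\<close> themselves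
  (\<open>future_measure_eq\<close>) and makes the norm definite (\<open>future_norm_eq_0_iff\<close>).
\<close>

section \<open>Auxiliary facts on finite measures and square-integrable functions\<close>

lemma (in finite_measure) measure_UN_infsum:
  assumes K: "countable K" and A: "\<And>i. i \<in> K \<Longrightarrow> A i \<in> sets M" and disj: "disjoint_family_on A K"
  shows "measure M (\<Union>i\<in>K. A i) = (\<Sum>\<^sub>\<infinity>i\<in>K. measure M (A i))"
proof -
  have *: "(\<integral>\<^sup>+i. ennreal (measure M (A i)) \<partial>count_space K) = emeasure M (\<Union>i\<in>K. A i)"
    using emeasure_UN_countable[OF A K disj] by (simp add: emeasure_eq_measure)
  have "integrable (count_space K) (\<lambda>i. measure M (A i))"
    by (rule integrableI_nonneg) (auto simp: * less_top[symmetric])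
  then have "Infinite_Set_Sum.abs_summable_on (\<lambda>i. measure M (A i)) K"
    by (simp add: Infinite_Set_Sum.abs_summable_on_def)
  then have "(\<Sum>\<^sub>\<infinity>i\<in>K. measure M (A i)) = infsetsum (\<lambda>i. measure M (A i)) K"
    by (simp add: infsetsum_infsum)
  also have "\<dots> = enn2real (\<integral>\<^sup>+i. ennreal (measure M (A i)) \<partial>count_space K)"
    unfolding infsetsum_def by (intro integral_eq_nn_integral) auto
  also have "\<dots> = measure M (\<Union>i\<in>K. A i)"
    unfolding * by (simp add: measure_def)
  finally show ?thesis ..
qed

text \<open>Where \<open>h > c\<close>, the excess \<open>h - c\<close> has a nonpositive integral, so this set is null.\<close>

lemma (in finite_measure) density_bounded_AE:
  fixes h :: "'a \<Rightarrow> real"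
  assumes h [measurable]: "h \<in> borel_measurable M" and nonneg: "\<And>x. 0 \<le> h x" and c: "0 \<le> c"
    and le: "\<And>B. B \<in> sets M \<Longrightarrow> emeasure (density M h) B \<le> ennreal c * emeasure M B"
  shows "AE x in M. h x \<le> c"
proof -
  define B where "B = {x \<in> space M. c < h x}"
  have B [measurable]: "B \<in> sets M"
    unfolding B_def by measurable
  have "(\<integral>\<^sup>+x. ennreal (h x) * indicator B x \<partial>M) = (\<integral>\<^sup>+x. ennreal (h x - c) * indicator B x + ennreal c * indicator B x \<partial>M)"
    by (intro nn_integral_cong)
      (auto simp: B_def indicator_def c ennreal_plus[symmetric] simp del: ennreal_plus)
  also have "\<dots> = (\<integral>\<^sup>+x. ennreal (h x - c) * indicator B x \<partial>M) + ennreal c * emeasure M B"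
    by (subst nn_integral_add) (auto simp: nn_integral_cmult)
  finally have "(\<integral>\<^sup>+x. ennreal (h x - c) * indicator B x \<partial>M) + ennreal c * emeasure M B
      \<le> 0 + ennreal c * emeasure M B"
    using le[OF B] by (simp add: emeasure_density)
  moreover have "ennreal c * emeasure M B \<noteq> \<infinity>"
    by (simp add: ennreal_mult_eq_top_iff)
  ultimately have "(\<integral>\<^sup>+x. ennreal (h x - c) * indicator B x \<partial>M) = 0"
    using ennreal_add_left_cancel_le[of "ennreal c * emeasure M B" _ 0] by (simp add: add.commute)
  then have "AE x in M. ennreal (h x - c) * indicator B x = 0"
    by (subst (asm) nn_integral_0_iff_AE) auto
  then show ?thesis
    using AE_space by eventually_elim (auto simp: B_def indicator_def ennreal_eq_0_iff split: if_splits)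
qed

text \<open>Minkowski's inequality for the exponent 2: the quadratic polynomial
  \<open>t \<mapsto> \<integral>(f + t g)\<^sup>2\<close> is nonnegative, which bounds its linear coefficient (Cauchy--Schwarz).\<close>

lemma L2_triangle_ineq:
  fixes f g :: "'a \<Rightarrow> real"
  assumes [measurable]: "f \<in> borel_measurable M" "g \<in> borel_measurable M"
    and f: "integrable M (\<lambda>x. f x * f x)" and g: "integrable M (\<lambda>x. g x * g x)"
  shows "sqrt (\<integral>x. (f x + g x) * (f x + g x) \<partial>M) \<le> sqrt (\<integral>x. f x * f x \<partial>M) + sqrt (\<integral>x. g x * g x \<partial>M)"
proof -
  have fg: "integrable M (\<lambda>x. f x * g x)"
  proof (rule Bochner_Integration.integrable_bound)
    show "integrable M (\<lambda>x. f x * f x + g x * g x)"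
      using f g by simp
    show "AE x in M. norm (f x * g x) \<le> norm (f x * f x + g x * g x)"
    proof (rule AE_I2)
      fix x
      have "2 * \<bar>f x * g x\<bar> \<le> f x * f x + g x * g x"
        using sum_squares_bound[of "\<bar>f x\<bar>" "\<bar>g x\<bar>"] by (simp add: abs_mult power2_eq_square)
      then show "norm (f x * g x) \<le> norm (f x * f x + g x * g x)"
        by simp
    qed
  qed simp
  define A where "A = (\<integral>x. f x * f x \<partial>M)"
  define B where "B = (\<integral>x. g x * g x \<partial>M)"
  define C where "C = (\<integral>x. f x * g x \<partial>M)"
  have A: "0 \<le> A" and B: "0 \<le> B"
    by (simp_all add: A_def B_def)
  have quad: "0 \<le> A + 2 * t * C + t * t * B" for t
  proof -
    have "0 \<le> (\<integral>x. (f x + t * g x) * (f x + t * g x) \<partial>M)"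
      by simp
    also have "\<dots> = (\<integral>x. f x * f x + 2 * t * (f x * g x) + t * t * (g x * g x) \<partial>M)"
      by (intro Bochner_Integration.integral_cong) (auto simp: algebra_simps)
    also have "\<dots> = A + 2 * t * C + t * t * B"
      using f g fg by (simp add: A_def B_def C_def)
    finally show ?thesis .
  qed
  have "C\<^sup>2 \<le> A * B"
  proof (cases "B = 0")
    case True
    have "C = 0"
      \<comment> \<open>The quadratic is now affine in \<open>t\<close>; with \<open>C \<noteq> 0\<close> it would take the value \<open>-1\<close> at this \<open>t\<close>.\<close>
      using quad[of "- (A + 1) / (2 * C)"] A True by (cases "C = 0") (auto simp: field_simps)
    then show ?thesis
      using A B by simp
  next
    case False
    then have "0 < B" using B by simp
    then show ?thesis
      \<comment> \<open>the minimizer of the quadratic\<close>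
      using quad[of "- C / B"] by (simp add: field_simps power2_eq_square)
  qed
  then have C: "C \<le> sqrt A * sqrt B"
    by (metis real_le_rsqrt real_sqrt_mult)
  have "(\<integral>x. (f x + g x) * (f x + g x) \<partial>M) = (\<integral>x. f x * f x + 2 * (f x * g x) + g x * g x \<partial>M)"
    by (intro Bochner_Integration.integral_cong) (auto simp: algebra_simps)
  also have "\<dots> = A + 2 * C + B"
    using f g fg by (simp add: A_def B_def C_def)
  also have "\<dots> \<le> (sqrt A + sqrt B)\<^sup>2"
    using A B C by (simp add: power2_sum)
  finally show ?thesis
    using A B by (simp add: A_def[symmetric] B_def[symmetric] real_le_lsqrt)
qed

section \<open>The cylinder \<open>\<sigma>\<close>-algebra on infinite sequences\<close>

abbreviation seq_space :: "'o stream measure"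
  where "seq_space \<equiv> stream_space (count_space UNIV)"

lemma mem_cyl_iff: "s \<in> cyl b \<longleftrightarrow> (\<forall>i<length b. s !! i = b ! i)"
  by (auto simp: cyl_def list_eq_iff_nth_eq)

lemma cyl_Nil [simp]: "cyl [] = UNIV"
  by (simp add: cyl_def)

lemma mem_cyl_append: "s \<in> cyl (a @ b) \<longleftrightarrow> s \<in> cyl a \<and> sdrop (length a) s \<in> cyl b"
proof -
  have "stake (length (a @ b)) s = stake (length a) s @ stake (length b) (sdrop (length a) s)"
    by (simp only: length_append stake_add)
  then show ?thesis
    by (simp add: cyl_def del: stake_add)
qed

lemma cyl_eq_sstart: "cyl b = sstart UNIV b"
  by (simp add: set_eq_iff mem_cyl_iff sstart_eq)

lemma sets_cyl [measurable]: "cyl b \<in> sets seq_space"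
  by (simp add: cyl_eq_sstart)

lemma disjoint_cyl: "length b = length c \<Longrightarrow> b \<noteq> c \<Longrightarrow> cyl b \<inter> cyl c = {}"
  by (auto simp: cyl_def)

lemma sets_seq_space:
  "sets (seq_space :: 'o::countable stream measure) = sigma_sets UNIV (insert {} (range cyl))"
  using sets_stream_space_sstart[of "UNIV :: 'o set"] by (simp add: cyl_eq_sstart[abs_def])

lemma Int_stable_cyl: "Int_stable (insert {} (range cyl))"
  using Int_stable_sstart[of UNIV] by (simp add: cyl_eq_sstart[abs_def])

lemma space_seq_space [simp]: "space seq_space = UNIV"
  by (simp add: space_stream_space)

lemma sigma_sets_cyl_algebra:
  "sigma_sets UNIV cyl_algebra = sets (seq_space :: 'o::countable stream measure)"
proof
  have "(\<Union>b\<in>K. cyl b) \<in> sets seq_space" for K :: "'o list set"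
    by (intro sets.countable_UN') auto
  then have "cyl_algebra \<subseteq> sets (seq_space :: 'o stream measure)"
    by (auto simp: cyl_algebra_def)
  then show "sigma_sets UNIV cyl_algebra \<subseteq> sets (seq_space :: 'o stream measure)"
    using sets.sigma_sets_subset[of cyl_algebra "seq_space :: 'o stream measure"] by simp
  have "cyl b \<in> sigma_sets UNIV cyl_algebra" for b :: "'o list"
  proof (cases "b = []")
    case False
    then have "length b \<in> {1..}"
      by (cases b) auto
    moreover have "cyl b = (\<Union>c\<in>{b}. cyl c)"
      by simp
    ultimately have "cyl b \<in> cyl_algebra"
      unfolding cyl_algebra_def by (intro UN_I[of "length b"]) auto
    then show ?thesis ..
  qed (simp add: sigma_sets_top)
  then have "sigma_sets UNIV (insert {} (range cyl)) \<subseteq> sigma_sets UNIV (cyl_algebra :: 'o stream set set)"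
    by (intro sigma_sets_mono) (auto intro: sigma_sets.Empty)
  then show "sets (seq_space :: 'o stream measure) \<subseteq> sigma_sets UNIV cyl_algebra"
    by (simp add: sets_seq_space)
qed

text \<open>Cylinders form an intersection-stable generator that contains the whole space
  \<open>cyl []\<close>, so a finite measure is determined by its values on them.\<close>

lemma measure_eqI_cyl:
  fixes N N' :: "'o::countable stream measure"
  assumes "finite_measure N" "sets N = sets seq_space" "sets N' = sets seq_space"
    and "\<And>b. emeasure N (cyl b) = emeasure N' (cyl b)"
  shows "N = N'"
proof (rule measure_eqI_generator_eq[OF Int_stable_cyl])
  interpret finite_measure N by fact
  show "range (\<lambda>_::nat. cyl [] :: 'o stream set) \<subseteq> insert {} (range cyl)"
    by blast
  show "emeasure N (cyl [] :: 'o stream set) \<noteq> \<infinity>" by simp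
qed (use assms in \<open>auto simp: sets_seq_space\<close>)

text \<open>Uniqueness of densities of signed measures. The positive and the negative part of \<open>f\<close>
  are densities of two finite measures that agree on cylinders, hence everywhere; then
  both parts agree almost everywhere, and one of them vanishes at every point.\<close>

lemma AE_zero_if_integral_cyl_zero:
  fixes N :: "'o::countable stream measure" and f :: "'o stream \<Rightarrow> real"
  assumes sets_N: "sets N = sets seq_space" and f: "integrable N f"
    and 0: "\<And>b. (\<integral>s. indicator (cyl b) s * f s \<partial>N) = 0"
  shows "AE s in N. f s = 0"
proof -
  note sets_N [measurable_cong]
  have [measurable]: "f \<in> borel_measurable N"
    using f by auto
  define P where "P = density N (\<lambda>s. ennreal (f s))"
  define Q where "Q = density N (\<lambda>s. ennreal (- f s))"
  have sp: "space N = UNIV"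
    using sets_eq_imp_space_eq[OF sets_N] by simp
  have int: "integrable N (\<lambda>s. indicator (cyl b) s * max 0 (g s))"
    if "integrable N g" for g :: "'o stream \<Rightarrow> real" and b
  proof -
    have "integrable N (\<lambda>s. max 0 (g s))"
      using that by simp
    from integrable_mult_indicator[OF _ this, of "cyl b"] show ?thesis
      by (simp add: sets_N sets_cyl)
  qed
  have E: "emeasure (density N (\<lambda>s. ennreal (g s))) (cyl b)
      = ennreal (\<integral>s. indicator (cyl b) s * max 0 (g s) \<partial>N)"
    if g: "integrable N g" for g :: "'o stream \<Rightarrow> real" and b
  proof -
    have [measurable]: "g \<in> borel_measurable N"
      using g by auto
    have "emeasure (density N (\<lambda>s. ennreal (g s))) (cyl b)
      = (\<integral>\<^sup>+s. ennreal (indicator (cyl b) s * max 0 (g s)) \<partial>N)"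
      by (subst emeasure_density)
        (auto intro!: nn_integral_cong simp: indicator_def max_def ennreal_neg)
    also have "\<dots> = ennreal (\<integral>s. indicator (cyl b) s * max 0 (g s) \<partial>N)"
      by (rule nn_integral_eq_integral[OF int[OF g]]) simp
    finally show ?thesis .
  qed
  have f': "integrable N (\<lambda>s. - f s)"
    using f by simp
  have "P = Q"
  proof (rule measure_eqI_cyl)
    show "finite_measure P"
      using E[OF f, of "[]"] by (intro finite_measureI) (simp add: P_def sp)
    fix b :: "'o list"
    have "(\<integral>s. indicator (cyl b) s * max 0 (f s) \<partial>N) - (\<integral>s. indicator (cyl b) s * max 0 (- f s) \<partial>N)
      = (\<integral>s. indicator (cyl b) s * f s \<partial>N)"
      unfolding Bochner_Integration.integral_diff[OF int[OF f] int[OF f'], symmetric]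
      by (intro Bochner_Integration.integral_cong) (auto simp: indicator_def)
    then show "emeasure P (cyl b) = emeasure Q (cyl b)"
      unfolding P_def Q_def E[OF f] E[OF f'] 0 by simp
  qed (auto simp: P_def Q_def sets_N)
  moreover have "(\<integral>\<^sup>+s. ennreal (f s) \<partial>N) \<noteq> \<infinity>"
    using E[OF f, of "[]"] emeasure_density[of "\<lambda>s. ennreal (f s)" N UNIV] sets.top[of N]
    by (simp add: sp) (metis ennreal_neq_top)
  ultimately have "AE s in N. ennreal (f s) = ennreal (- f s)"
    unfolding P_def Q_def by (subst (asm) finite_density_unique) auto
  then show ?thesis
  proof eventually_elim
    case (elim s)
    then show ?case
      by (cases "f s \<ge> 0") (auto simp: ennreal_neg ennreal_eq_0_iff)
  qed
qed

section \<open>The law of the future and its densities\<close>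

locale stationary =
  fixes M :: "'w measure" and X :: "int \<Rightarrow> 'w \<Rightarrow> 'o::countable"
  assumes stationary: "stationary_process M X"
begin

sublocale prob_space M
  using stationary by (simp add: stationary_process_def)

lemma measurable_X [measurable]: "X t \<in> measurable M (count_space UNIV)"
  using stationary by (simp add: stationary_process_def)

lemma stationarity:
  assumes "length ts = length xs"
  shows "measure M {w \<in> space M. \<forall>i<length xs. X (ts ! i) w = xs ! i} =
    measure M {w \<in> space M. \<forall>i<length xs. X (ts ! i + l) w = xs ! i}"
  using stationary assms unfolding stationary_process_def by blast

definition future_path :: "'w \<Rightarrow> 'o stream"
  where "future_path w = to_stream (\<lambda>n. X (int n + 1) w)"

lemma snth_future_path [simp]: "future_path w !! n = X (int n + 1) w"
  by (simp add: future_path_def to_stream_def)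

lemma measurable_future_path [measurable]: "future_path \<in> measurable M seq_space"
  by (rule measurable_stream_space2) simp

definition law :: "'o stream measure"
  where "law = distr M seq_space future_path"

lemma sets_law [measurable_cong]: "sets law = sets seq_space"
  and space_law [simp]: "space law = UNIV"
  by (simp_all add: law_def)

sublocale law: prob_space law
  unfolding law_def by (rule prob_space_distr) simp

lemma measure_law_cyl: "measure law (cyl b) = word_prob M X b"
  unfolding law_def word_prob_def
  by (subst measure_distr) (auto intro!: arg_cong[where f="measure M"] simp: mem_cyl_iff)

lemma word_prob_Nil: "word_prob M X [] = 1"
  using law.prob_space by (simp flip: measure_law_cyl)

lemma word_prob_nonneg: "0 \<le> word_prob M X b"
  by (simp add: word_prob_def)

text \<open>Stationarity of the process is only a statement on finitely many coordinates; on
  cylinders it says that the law of the future is shift invariant.\<close>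

lemma distr_law_sdrop: "distr law seq_space (sdrop n) = law"
proof (rule measure_eqI_cyl)
  show "finite_measure (distr law seq_space (sdrop n))"
    by (rule law.finite_measure_distr) simp
  fix b :: "'o list"
  have "measure (distr law seq_space (sdrop n)) (cyl b) = measure law (sdrop n -` cyl b)"
    by (subst measure_distr) auto
  also have "\<dots> = measure M (future_path -` (sdrop n -` cyl b) \<inter> space M)"
    unfolding law_def using measurable_sets[OF measurable_sdrop sets_cyl, of n b]
    by (subst measure_distr) auto
  also have "future_path -` (sdrop n -` cyl b) \<inter> space M
      = {w \<in> space M. \<forall>i<length b. X (map (\<lambda>i. int i + 1) [0..<length b] ! i + int n) w = b ! i}"
    by (auto simp: mem_cyl_iff sdrop_snth algebra_simps)
  also have "measure M \<dots>
      = measure M {w \<in> space M. \<forall>i<length b. X (map (\<lambda>i. int i + 1) [0..<length b] ! i) w = b ! i}"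
    by (rule stationarity[symmetric]) simp
  also have "\<dots> = word_prob M X b"
    unfolding word_prob_def by (rule arg_cong[where f="measure M"]) auto
  finally have "measure (distr law seq_space (sdrop n)) (cyl b) = measure law (cyl b)"
    by (simp add: measure_law_cyl)
  then show "emeasure (distr law seq_space (sdrop n)) (cyl b) = emeasure law (cyl b)"
    by (simp add: law.emeasure_eq_measure
        finite_measure.emeasure_eq_measure[OF law.finite_measure_distr])
qed (simp_all add: sets_law)

text \<open>The measure \<open>P(a) \<mu>\<^sub>a\<close>, which exists without division by \<open>P(a)\<close>: the law of the
  continuation of \<open>a\<close>, restricted to the event that the sequence starts with \<open>a\<close>.\<close>

definition joint_measure :: "'o list \<Rightarrow> 'o stream measure"
  where "joint_measure a = distr (density law (indicator (cyl a))) seq_space (sdrop (length a))"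

lemma sets_joint_measure [measurable_cong]: "sets (joint_measure a) = sets seq_space"
  and space_joint_measure [simp]: "space (joint_measure a) = UNIV"
  by (simp_all add: joint_measure_def)

lemma emeasure_joint_measure:
  assumes [measurable]: "B \<in> sets seq_space"
  shows "emeasure (joint_measure a) B = emeasure law (cyl a \<inter> sdrop (length a) -` B)"
proof -
  have [measurable]: "sdrop (length a) -` B \<in> sets seq_space"
    using measurable_sets[OF measurable_sdrop assms, of "length a"] by simp
  have "emeasure (joint_measure a) B = (\<integral>\<^sup>+s. indicator (cyl a) s * indicator (sdrop (length a) -` B) s \<partial>law)"
    unfolding joint_measure_def by (subst emeasure_distr) (auto simp: emeasure_density sets_law)
  also have "\<dots> = (\<integral>\<^sup>+s. indicator (cyl a \<inter> sdrop (length a) -` B) s \<partial>law)"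
    by (intro nn_integral_cong) (auto simp: indicator_def)
  also have "\<dots> = emeasure law (cyl a \<inter> sdrop (length a) -` B)"
    by (intro nn_integral_indicator) (simp add: sets_law)
  finally show ?thesis .
qed

lemma emeasure_joint_measure_cyl: "emeasure (joint_measure a) (cyl b) = word_prob M X (a @ b)"
proof -
  have "cyl a \<inter> sdrop (length a) -` cyl b = cyl (a @ b)"
    by (auto simp: mem_cyl_append)
  then show ?thesis
    by (simp add: emeasure_joint_measure law.emeasure_eq_measure measure_law_cyl)
qed

lemma word_prob_append_eq_0: "word_prob M X a = 0 \<Longrightarrow> word_prob M X (a @ b) = 0"
proof -
  have "measure law (cyl (a @ b)) \<le> measure law (cyl a)"
    by (rule law.finite_measure_mono) (auto simp: mem_cyl_append sets_law)
  then show "word_prob M X a = 0 \<Longrightarrow> word_prob M X (a @ b) = 0"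
    using word_prob_nonneg[of "a @ b"] by (simp add: measure_law_cyl)
qed

text \<open>The source of all bounds below: forgetting that the first letters were \<open>a\<close> only increases
  the measure, and by shift invariance what remains is the law of the future itself.\<close>

lemma emeasure_joint_measure_le:
  assumes [measurable]: "B \<in> sets seq_space"
  shows "emeasure (joint_measure a) B \<le> emeasure law B"
proof -
  have *: "sdrop (length a) -` B \<in> sets law"
    using measurable_sets[OF measurable_sdrop assms, of "length a"] by (simp add: sets_law)
  have "emeasure (joint_measure a) B \<le> emeasure law (sdrop (length a) -` B)"
    unfolding emeasure_joint_measure[OF assms] by (rule emeasure_mono[OF _ *]) auto
  also have "\<dots> = emeasure (distr law seq_space (sdrop (length a))) B"
    by (subst emeasure_distr) auto
  finally show ?thesis
    by (simp add: distr_law_sdrop)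
qed

text \<open>The convention \<open>x / 0 = 0\<close> agrees with \<open>g\<^sub>a = 0\<close> for impossible words \<open>a\<close>, and it makes
  the next identity hold for all words.\<close>

lemma future_fun_eq: "future_fun M X a b = word_prob M X (a @ b) / word_prob M X a"
  by (simp add: future_fun_def)

text \<open>The right-hand side has the values \<open>g\<^sub>a(b)\<close> on cylinders, and countable additivity
  extends this to unions of cylinders over words of equal length. So it satisfies the
  characterization of \<open>\<mu>\<^sub>a\<close>, and cylinders determine the measure.\<close>

lemma future_measure_eq: "future_measure M X a = scale_measure (ennreal (1 / word_prob M X a)) (joint_measure a)"
  (is "_ = ?N")
proof -
  have emeasure_N: "emeasure ?N (cyl b) = future_fun M X a b" for b
  proof -
    have "emeasure ?N (cyl b) = ennreal (1 / word_prob M X a) * ennreal (word_prob M X (a @ b))"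
      by (simp add: emeasure_joint_measure_cyl)
    also have "\<dots> = ennreal (1 / word_prob M X a * word_prob M X (a @ b))"
      by (rule ennreal_mult[symmetric]) (simp_all add: word_prob_nonneg)
    finally show ?thesis
      by (simp add: future_fun_eq)
  qed
  have N: "finite_measure ?N"
    using emeasure_N[of "[]"] by (intro finite_measureI) (simp add: space_scale_measure)
  have sets_N: "sets ?N = sets seq_space"
    by (simp add: sets_joint_measure)
  have UN: "measure N' (\<Union>b\<in>K. cyl b) = (\<Sum>\<^sub>\<infinity>b\<in>K. measure N' (cyl b))"
    if "finite_measure N'" "sets N' = sets seq_space" "K \<subseteq> {b. length b = k}"
    for N' and K :: "'o list set" and k
    by (rule finite_measure.measure_UN_infsum[OF that(1)])
      (use that in \<open>auto simp: disjoint_family_on_def disjoint_cyl subset_eq\<close>)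
  have measure_N: "measure ?N (cyl b) = future_fun M X a b" for b
    using emeasure_N[of b] by (simp add: measure_def future_fun_eq word_prob_nonneg)
  show ?thesis
    unfolding future_measure_def
  proof (rule the_equality, intro conjI allI impI)
    show "finite_measure ?N" by fact
    show "space ?N = UNIV" by (simp add: space_scale_measure)
    show "sets ?N = sigma_sets UNIV cyl_algebra"
      by (simp only: sets_N sigma_sets_cyl_algebra)
    fix k K assume "1 \<le> k" "K \<subseteq> {b::'o list. length b = k}"
    then show "measure ?N (\<Union>b\<in>K. cyl b) = (\<Sum>\<^sub>\<infinity>b\<in>K. future_fun M X a b)"
      using UN[OF N sets_N] by (simp add: measure_N)
  next
    fix N' :: "'o stream measure"
    assume *: "finite_measure N' \<and> space N' = UNIV \<and> sets N' = sigma_sets UNIV cyl_algebra \<and>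
      (\<forall>k\<ge>1. \<forall>K\<subseteq>{b. length b = k}. measure N' (\<Union>b\<in>K. cyl b) = (\<Sum>\<^sub>\<infinity>b\<in>K. future_fun M X a b))"
    then have N': "finite_measure N'" and sets_N': "sets N' = sets seq_space"
      and UN': "\<And>k K. k \<ge> 1 \<Longrightarrow> K \<subseteq> {b. length b = k} \<Longrightarrow>
        measure N' (\<Union>b\<in>K. cyl b) = (\<Sum>\<^sub>\<infinity>b\<in>K. future_fun M X a b)"
      by (simp_all add: sigma_sets_cyl_algebra)
    have "measure N' (cyl b) = measure ?N (cyl b)" for b
    proof -
      \<comment> \<open>The defining equations are about words of positive length; the whole space is the
        union of the cylinders over single letters.\<close>
      define K where "K = (if b = [] then {c. length c = 1} else {b})"
      have K: "K \<subseteq> {c. length c = max 1 (length b)}"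
        by (cases b) (auto simp: K_def)
      have "cyl b = (\<Union>c\<in>K. cyl c)"
      proof (cases "b = []")
        case True
        have "s \<in> (\<Union>c\<in>K. cyl c)" for s
          by (rule UN_I[of "[shd s]"]) (simp_all add: K_def True mem_cyl_iff)
        with True show ?thesis
          by auto
      qed (simp add: K_def)
      then show ?thesis
        using UN'[OF _ K] UN[OF N sets_N K] by (simp add: measure_N)
    qed
    then show "N' = ?N"
      by (intro measure_eqI_cyl[OF N' sets_N' sets_N])
        (simp only: finite_measure.emeasure_eq_measure[OF N] finite_measure.emeasure_eq_measure[OF N'])
  qed
qed

lemma measure_future_measure_cyl: "measure (future_measure M X a) (cyl b) = future_fun M X a b"
  by (simp add: future_measure_eq future_fun_eq word_prob_nonneg measure_def emeasure_joint_measure_cyl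
      enn2real_mult)

lemma future_measure_Nil: "future_measure M X [] = law"
proof -
  have "joint_measure [] = law"
    by (rule measure_eqI) (simp_all add: emeasure_joint_measure sets_joint_measure sets_law vimage_def)
  then show ?thesis
    by (simp add: future_measure_eq word_prob_Nil)
qed

text \<open>Domination by \<open>\<mu>\<^sub>\<epsilon>\<close> gives absolute continuity, and finiteness of \<open>\<mu>\<^sub>a\<close> makes its
  Radon--Nikodym derivative finite almost everywhere; so passing to real values in
  the definition of the density loses nothing.\<close>

lemma
  shows measurable_future_density [measurable]: "future_density M X a \<in> borel_measurable law"
    and future_density_nonneg: "0 \<le> future_density M X a s"
    and density_future_density: "density law (future_density M X a) = future_measure M X a"
proof -
  show [measurable]: "future_density M X a \<in> borel_measurable law"
    unfolding future_density_def future_measure_Nil by measurable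
  show "0 \<le> future_density M X a s"
    by (simp add: future_density_def)
  have sets: "sets (future_measure M X a) = sets law"
    by (simp add: future_measure_eq sets_joint_measure sets_law)
  have "emeasure (future_measure M X a) (space (future_measure M X a)) \<noteq> \<infinity>"
    using emeasure_joint_measure_cyl[of a "[]"]
    by (simp add: future_measure_eq space_scale_measure ennreal_mult_eq_top_iff)
  then interpret N: finite_measure "future_measure M X a"
    by (rule finite_measureI)
  have ac: "absolutely_continuous law (future_measure M X a)"
    unfolding absolutely_continuous_def
  proof
    fix B assume B: "B \<in> null_sets law"
    then have "emeasure (joint_measure a) B = 0"
      using emeasure_joint_measure_le[of B a] by (auto simp: null_sets_def sets_law)
    with B show "B \<in> null_sets (future_measure M X a)"
      by (auto simp: null_sets_def sets_joint_measure sets_law future_measure_eq)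
  qed
  have "AE s in law. RN_deriv law (future_measure M X a) s = ennreal (future_density M X a s)"
    using law.RN_deriv_finite[OF N.sigma_finite_measure_axioms ac sets]
    by eventually_elim (simp add: future_density_def future_measure_Nil less_top)
  then have "density law (future_density M X a) = density law (RN_deriv law (future_measure M X a))"
    by (intro density_cong) auto
  also have "\<dots> = future_measure M X a"
    by (rule law.density_RN_deriv[OF ac sets])
  finally show "density law (future_density M X a) = future_measure M X a" .
qed

text \<open>Boundedness of the densities makes every product of them integrable, so the inner
  product is defined by genuine integrals.\<close>

lemma future_density_bounded: "AE s in law. future_density M X a s \<le> 1 / word_prob M X a"
proof (rule law.density_bounded_AE)
  fix B assume "B \<in> sets law"
  then show "emeasure (density law (future_density M X a)) B \<le> ennreal (1 / word_prob M X a) * emeasure law B"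
    unfolding density_future_density future_measure_eq
    by (auto simp: sets_law intro!: mult_left_mono emeasure_joint_measure_le)
qed (auto simp: word_prob_nonneg future_density_nonneg)

lemma density_weight: "density law (\<lambda>s. word_prob M X a * future_density M X a s) = joint_measure a"
proof (rule measure_eqI)
  fix B assume "B \<in> sets (density law (\<lambda>s. word_prob M X a * future_density M X a s))"
  then have B [measurable]: "B \<in> sets law" by simp
  have "emeasure (density law (\<lambda>s. word_prob M X a * future_density M X a s)) B
     = word_prob M X a * emeasure (density law (future_density M X a)) B"
    by (simp add: emeasure_density ennreal_mult word_prob_nonneg future_density_nonneg
         mult.assoc nn_integral_cmult)
  also have "\<dots> = emeasure (joint_measure a) B"
  proof (cases "word_prob M X a = 0")
    case True
    have "emeasure (joint_measure a) B \<le> emeasure (joint_measure a) (cyl [])"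
      by (rule emeasure_mono) (simp_all only: sets_joint_measure sets_cyl, simp)
    then show ?thesis
      using True by (simp add: emeasure_joint_measure_cyl del: cyl_Nil)
  next
    case False
    then have "ennreal (word_prob M X a) * ennreal (1 / word_prob M X a) = 1"
      by (subst ennreal_mult[symmetric]) (simp_all add: word_prob_nonneg)
    then show ?thesis
      by (simp add: density_future_density future_measure_eq flip: mult.assoc)
  qed
  finally show "emeasure (density law (\<lambda>s. word_prob M X a * future_density M X a s)) B = emeasure (joint_measure a) B" .
qed (simp add: sets_law sets_joint_measure)

end

section \<open>Prepending a letter to a density\<close>

context stationary
begin

text \<open>The density of \<open>P(a) \<mu>\<^sub>a\<close>, equivalently the conditional probability that the letter \<open>a\<close>
  precedes a given future. In particular it is at most 1.\<close>

definition weight :: "'o \<Rightarrow> 'o stream \<Rightarrow> real"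
  where "weight a s = word_prob M X [a] * future_density M X [a] s"

lemma measurable_weight [measurable]: "weight a \<in> borel_measurable law"
  unfolding weight_def by measurable

lemma weight_nonneg: "0 \<le> weight a s"
  by (simp add: weight_def word_prob_nonneg future_density_nonneg)

lemma weight_le_1: "AE s in law. weight a s \<le> 1"
  using future_density_bounded[of "[a]"]
proof eventually_elim
  case (elim s)
  then have "weight a s \<le> word_prob M X [a] * (1 / word_prob M X [a])"
    unfolding weight_def by (rule mult_left_mono) (rule word_prob_nonneg)
  then show ?case
    by (cases "word_prob M X [a] = 0") auto
qed

lemma joint_measure_eq_weight: "joint_measure [a] = density law (weight a)"
  using density_weight[of "[a]"] by (simp add: weight_def[abs_def])

lemma mem_cyl_single: "s \<in> cyl [a] \<longleftrightarrow> shd s = a"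
  by (simp add: mem_cyl_iff)

lemma measurable_SCons_law [measurable (raw)]:
  assumes F: "F \<in> measurable law N"
  shows "(\<lambda>s. F (a ## s)) \<in> measurable law N"
proof (rule measurable_compose[OF _ F])
  show "(##) a \<in> measurable law law"
    by (simp add: measurable_cong_sets[OF sets_law sets_law])
qed

text \<open>Change of variables along the prefixing map \<open>s \<mapsto> a ## s\<close>: the measure with density
  \<open>weight a\<close> is the image of the law on \<open>cyl [a]\<close> under removal of the first letter.\<close>

lemma integral_weight_SCons:
  fixes F :: "'o stream \<Rightarrow> real"
  assumes [measurable]: "F \<in> borel_measurable law"
  shows "(\<integral>s. weight a s * F (a ## s) \<partial>law) = (\<integral>s. indicator (cyl [a]) s * F s \<partial>law)"
proof -
  have [measurable]: "F \<in> borel_measurable seq_space"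
    using assms by (simp add: measurable_cong_sets[OF sets_law refl])
  have "(\<integral>s. weight a s * F (a ## s) \<partial>law) = (\<integral>s. F (a ## s) \<partial>joint_measure [a])"
    unfolding joint_measure_eq_weight by (subst integral_density) (auto simp: weight_nonneg)
  also have "\<dots> = (\<integral>s. F (a ## sdrop 1 s) \<partial>density law (\<lambda>s. ennreal (indicator (cyl [a]) s)))"
    unfolding joint_measure_def by (subst integral_distr) (auto simp: ennreal_indicator)
  also have "\<dots> = (\<integral>s. indicator (cyl [a]) s * F (a ## sdrop 1 s) \<partial>law)"
    by (subst integral_density) auto
  also have "\<dots> = (\<integral>s. indicator (cyl [a]) s * F s \<partial>law)"
    by (intro Bochner_Integration.integral_cong) (auto simp: indicator_def mem_cyl_single)
  finally show ?thesis .
qed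

text \<open>The image of a null set under removal of a leading \<open>a\<close> need only be null where the
  weight is positive, which is why the conclusion is restricted to such sequences.\<close>

lemma AE_weight_SCons:
  assumes [measurable]: "Measurable.pred law Q" and Q: "AE s in law. Q s"
  shows "AE s in law. weight a s \<noteq> 0 \<longrightarrow> Q (a ## s)"
proof -
  have [measurable]: "Measurable.pred seq_space Q"
    using assms(1) by (simp add: measurable_cong_sets[OF sets_law refl])
  have "AE s in density law (indicator (cyl [a])). Q (a ## sdrop 1 s)"
    by (subst AE_density) (use Q in \<open>auto simp: indicator_def mem_cyl_single elim!: eventually_mono\<close>)
  moreover have "{s \<in> space seq_space. Q (a ## s)} \<in> sets seq_space"
    by measurable
  ultimately have "AE s in joint_measure [a]. Q (a ## s)"
    unfolding joint_measure_def by (subst AE_distr_iff) auto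
  then show ?thesis
    unfolding joint_measure_eq_weight
    by (subst (asm) AE_density) (auto simp: weight_nonneg less_le elim!: eventually_mono)
qed

text \<open>An almost everywhere bounded \<open>f\<close> whose class in \<open>L\<^sup>2\<close> is the candidate for \<open>\<phi>(g)\<close>: the signed measure
  with density \<open>f\<close> has the values \<open>g(b)\<close> on cylinders. The bound makes \<open>f\<close> integrable and
  square-integrable.\<close>

definition represents :: "('o stream \<Rightarrow> real) \<Rightarrow> ('o list \<Rightarrow> real) \<Rightarrow> bool"
  where "represents f g \<longleftrightarrow> f \<in> borel_measurable law \<and> (\<exists>C. AE s in law. \<bar>f s\<bar> \<le> C) \<and>
    (\<forall>b. (\<integral>s. indicator (cyl b) s * f s \<partial>law) = g b)"

lemma represents_measurable: "represents f g \<Longrightarrow> f \<in> borel_measurable law"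
  by (simp add: represents_def)

lemma represents_integrable:
  assumes "represents f g"
  shows "integrable law f" "integrable law (\<lambda>s. f s * f s)"
proof -
  obtain C where C: "AE s in law. \<bar>f s\<bar> \<le> C" and [measurable]: "f \<in> borel_measurable law"
    using assms by (auto simp: represents_def)
  show "integrable law f"
    by (rule law.integrable_const_bound[of _ C]) (use C in auto)
  show "integrable law (\<lambda>s. f s * f s)"
  proof (rule law.integrable_const_bound[of _ "C * C"])
    show "AE s in law. norm (f s * f s) \<le> C * C"
      using C
    proof eventually_elim
      case (elim s)
      then have "\<bar>f s\<bar> * \<bar>f s\<bar> \<le> C * C"
        by (intro mult_mono') auto
      then show ?case
        by simp
    qed
  qed simp
qed

lemma integrable_indicator_cyl:
  assumes "integrable law f"
  shows "integrable law (\<lambda>s. indicator (cyl b) s * f s :: real)"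
  using integrable_mult_indicator[OF _ assms, of "cyl b"] by (simp add: sets_law sets_cyl)

text \<open>This is what makes the embedding independent of the basis: two densities with the same
  cylinder integrals define the same class.\<close>

lemma represents_unique:
  assumes f: "represents f g" and f': "represents f' g"
  shows "AE s in law. f s = f' s"
proof -
  note int = represents_integrable(1)[OF f] represents_integrable(1)[OF f']
  have "AE s in law. f s - f' s = 0"
  proof (rule AE_zero_if_integral_cyl_zero)
    fix b
    have "(\<integral>s. indicator (cyl b) s * (f s - f' s) \<partial>law)
        = (\<integral>s. indicator (cyl b) s * f s \<partial>law) - (\<integral>s. indicator (cyl b) s * f' s \<partial>law)"
      using int[THEN integrable_indicator_cyl] by (simp add: right_diff_distrib)
    then show "(\<integral>s. indicator (cyl b) s * (f s - f' s) \<partial>law) = 0"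
      using f f' by (simp add: represents_def)
  qed (use int sets_law in auto)
  then show ?thesis by simp
qed

lemma represents_zero: "represents 0 0"
  by (auto simp: represents_def zero_fun_def)

lemma represents_scaleR_add:
  assumes f: "represents f g" and f': "represents f' g'"
  shows "represents (r *\<^sub>R f + f') (r *\<^sub>R g + g')"
  unfolding represents_def
proof (intro conjI allI)
  note [measurable] = f[THEN represents_measurable] f'[THEN represents_measurable]
  show "r *\<^sub>R f + f' \<in> borel_measurable law"
    unfolding scaleR_fun_def plus_fun_def by measurable
  obtain C C' where "AE s in law. \<bar>f s\<bar> \<le> C" "AE s in law. \<bar>f' s\<bar> \<le> C'"
    using f f' by (auto simp: represents_def)
  then have "AE s in law. \<bar>(r *\<^sub>R f + f') s\<bar> \<le> \<bar>r\<bar> * C + C'"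
  proof eventually_elim
    case (elim s)
    have "\<bar>(r *\<^sub>R f + f') s\<bar> \<le> \<bar>r\<bar> * \<bar>f s\<bar> + \<bar>f' s\<bar>"
      using abs_triangle_ineq[of "r * f s" "f' s"] by (simp add: scaleR_fun_def abs_mult)
    also have "\<dots> \<le> \<bar>r\<bar> * C + C'"
      using elim by (intro add_mono mult_left_mono) auto
    finally show ?case .
  qed
  then show "\<exists>D. AE s in law. \<bar>(r *\<^sub>R f + f') s\<bar> \<le> D" ..
  fix b
  have "(\<integral>s. indicator (cyl b) s * (r *\<^sub>R f + f') s \<partial>law)
      = (\<integral>s. r * (indicator (cyl b) s * f s) + indicator (cyl b) s * f' s \<partial>law)"
    by (simp add: scaleR_fun_def algebra_simps)
  also have "\<dots> = r * g b + g' b"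
    using integrable_indicator_cyl[OF represents_integrable(1)[OF f]]
      integrable_indicator_cyl[OF represents_integrable(1)[OF f']] f f'
    by (simp add: represents_def)
  finally show "(\<integral>s. indicator (cyl b) s * (r *\<^sub>R f + f') s \<partial>law) = (r *\<^sub>R g + g') b"
    by (simp add: scaleR_fun_def)
qed

lemma represents_future_density: "represents (future_density M X c) (future_fun M X c)"
  unfolding represents_def
proof (intro conjI allI exI)
  show "AE s in law. \<bar>future_density M X c s\<bar> \<le> 1 / word_prob M X c"
    using future_density_bounded by (simp add: future_density_nonneg)
  fix b
  have "(\<integral>s. indicator (cyl b) s * future_density M X c s \<partial>law)
      = (\<integral>s. indicator (cyl b) s \<partial>density law (future_density M X c))"
    by (subst integral_density) (auto simp: future_density_nonneg mult.commute)
  also have "\<dots> = measure (future_measure M X c) (cyl b)"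
    by (simp add: density_future_density future_measure_eq space_scale_measure)
  finally show "(\<integral>s. indicator (cyl b) s * future_density M X c s \<partial>law) = future_fun M X c b"
    by (simp add: measure_future_measure_cyl)
qed simp

text \<open>The action of the observable operator, seen on densities. If \<open>f\<close> is a density for \<open>g\<close>,
  then the change of variables turns the integral of \<open>weight a s * f (a ## s)\<close> over \<open>cyl b\<close>
  into the integral of \<open>f\<close> over \<open>cyl (a # b)\<close>.\<close>

lemma represents_SCons:
  assumes f: "represents f g"
  shows "represents (\<lambda>s. weight a s * f (a ## s)) (\<lambda>b. g (a # b))"
  unfolding represents_def
proof (intro conjI allI)
  note [measurable] = f[THEN represents_measurable]
  show "(\<lambda>s. weight a s * f (a ## s)) \<in> borel_measurable law"
    by measurable
  obtain C where "AE s in law. \<bar>f s\<bar> \<le> C"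
    using f by (auto simp: represents_def)
  then have "AE s in law. weight a s \<noteq> 0 \<longrightarrow> \<bar>f (a ## s)\<bar> \<le> C"
    by (intro AE_weight_SCons) auto
  with weight_le_1[of a] have "AE s in law. \<bar>weight a s * f (a ## s)\<bar> \<le> max 0 C"
  proof eventually_elim
    case (elim s)
    then show ?case
      using mult_mono[of "weight a s" 1 "\<bar>f (a ## s)\<bar>" "max 0 C"] weight_nonneg[of a s]
      by (cases "weight a s = 0") (auto simp: abs_mult)
  qed
  then show "\<exists>C. AE s in law. \<bar>weight a s * f (a ## s)\<bar> \<le> C" ..
  fix b
  have "s \<in> cyl (a # b) \<longleftrightarrow> s \<in> cyl [a] \<and> stl s \<in> cyl b" for s
    using mem_cyl_append[of s "[a]" b] by simp
  then have *: "indicator (cyl b) s = (indicator (cyl (a # b)) (a ## s) :: real)" for s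
    by (auto simp: indicator_def mem_cyl_single)
  have "(\<integral>s. indicator (cyl b) s * (weight a s * f (a ## s)) \<partial>law)
      = (\<integral>s. weight a s * (indicator (cyl (a # b)) (a ## s) * f (a ## s)) \<partial>law)"
    by (simp add: * ac_simps)
  also have "\<dots> = (\<integral>s. indicator (cyl [a]) s * (indicator (cyl (a # b)) s * f s) \<partial>law)"
    by (rule integral_weight_SCons) measurable
  also have "\<dots> = (\<integral>s. indicator (cyl (a # b)) s * f s \<partial>law)"
    by (intro Bochner_Integration.integral_cong refl)
      (auto simp: indicator_def mem_cyl_append[of _ "[a]" b, simplified])
  finally show "(\<integral>s. indicator (cyl b) s * (weight a s * f (a ## s)) \<partial>law) = g (a # b)"
    using f by (simp add: represents_def)
qed

text \<open>The contraction estimate. As \<open>0 \<le> weight a \<le> 1\<close>, one of the two factors \<open>weight a\<close> can be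
  dropped, and the change of variables identifies what remains with the integral of \<open>f\<^sup>2\<close>
  over \<open>cyl [a]\<close>.\<close>

lemma integral_square_SCons_le:
  assumes f: "represents f g"
  shows "(\<integral>s. (weight a s * f (a ## s)) * (weight a s * f (a ## s)) \<partial>law) \<le> (\<integral>s. f s * f s \<partial>law)"
proof -
  note [measurable] = f[THEN represents_measurable]
  obtain C where "AE s in law. \<bar>f s\<bar> \<le> C"
    using f by (auto simp: represents_def)
  then have "AE s in law. weight a s \<noteq> 0 \<longrightarrow> \<bar>f (a ## s)\<bar> \<le> C"
    by (intro AE_weight_SCons) auto
  with weight_le_1[of a] have "AE s in law. \<bar>weight a s * (f (a ## s) * f (a ## s))\<bar> \<le> C * C"
  proof eventually_elim
    case (elim s)
    show ?case
    proof (cases "weight a s = 0")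
      case False
      then have "weight a s * (\<bar>f (a ## s)\<bar> * \<bar>f (a ## s)\<bar>) \<le> 1 * (C * C)"
        using elim by (intro mult_mono) (auto simp: weight_nonneg)
      then show ?thesis
        by (simp add: abs_mult weight_nonneg)
    qed simp
  qed
  then have int: "integrable law (\<lambda>s. weight a s * (f (a ## s) * f (a ## s)))"
    by (intro law.integrable_const_bound[of _ "C * C"]) auto
  have "(\<integral>s. (weight a s * f (a ## s)) * (weight a s * f (a ## s)) \<partial>law)
      \<le> (\<integral>s. weight a s * (f (a ## s) * f (a ## s)) \<partial>law)"
  proof (rule integral_mono_AE)
    show "AE s in law. (weight a s * f (a ## s)) * (weight a s * f (a ## s)) \<le> weight a s * (f (a ## s) * f (a ## s))"
      using weight_le_1[of a]
    proof eventually_elim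
      case (elim s)
      then have "weight a s * (weight a s * (f (a ## s) * f (a ## s))) \<le> 1 * (weight a s * (f (a ## s) * f (a ## s)))"
        by (intro mult_right_mono) (auto simp: weight_nonneg)
      then show ?case
        by (simp add: ac_simps)
    qed
  qed (use int represents_integrable(2)[OF represents_SCons[OF f]] in auto)
  also have "\<dots> = (\<integral>s. indicator (cyl [a]) s * (f s * f s) \<partial>law)"
    by (rule integral_weight_SCons) measurable
  also have "\<dots> \<le> (\<integral>s. f s * f s \<partial>law)"
    using represents_integrable(2)[OF f]
    by (intro integral_mono integrable_indicator_cyl) (auto simp: indicator_def)
  finally show ?thesis .
qed

end

section \<open>The observable operators are contractions\<close>

locale stationary_basis = stationary M X
  for M :: "'w measure" and X :: "int \<Rightarrow> 'w \<Rightarrow> 'o::countable" +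
  fixes L :: "'o list set"
  assumes basis: "future_basis M X L"
begin

lemma linear_future_extend: "linear (future_extend M X L v)"
  using basis unfolding future_extend_def by (intro linear_construct) (simp add: future_basis_def)

lemma future_extend_basis: "c \<in> L \<Longrightarrow> future_extend M X L v (future_fun M X c) = v c"
  using basis by (simp add: future_extend_def construct_basis future_basis_def)

lemma future_space_induct [consumes 1, case_names zero step]:
  assumes "g \<in> future_space M X" "Q 0"
    and "\<And>r c g. c \<in> L \<Longrightarrow> Q g \<Longrightarrow> Q (r *\<^sub>R future_fun M X c + g)"
  shows "Q g"
proof -
  have "g \<in> span (future_fun M X ` L)"
    using assms(1) basis by (simp add: future_basis_def)
  then show ?thesis
  proof (induction rule: span_induct_alt)
    case (step r g h)
    then show ?case
      using assms(3) by (metis imageE)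
  qed (rule assms(2))
qed

lemma future_extend_simps:
  "future_extend M X L v 0 = 0"
  "c \<in> L \<Longrightarrow> future_extend M X L v (r *\<^sub>R future_fun M X c + g) = r *\<^sub>R v c + future_extend M X L v g"
  using linear_future_extend[of v]
  by (simp_all add: linear_0 linear_add linear_scale future_extend_basis)

lemma represents_future_embed:
  assumes "g \<in> future_space M X"
  shows "represents (future_embed M X L g) g"
  using assms unfolding future_embed_def
  by (induction rule: future_space_induct)
    (simp_all only: future_extend_simps represents_zero represents_scaleR_add represents_future_density)

lemma observable_op_in_future_space: "g \<in> future_space M X \<Longrightarrow> observable_op M X L a g \<in> future_space M X"
  unfolding observable_op_def
  by (induction rule: future_space_induct)
    (simp_all only: future_extend_simps future_space_def span_zero span_add span_scale span_base rangeI)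

text \<open>On a basis function this is the chain rule \<open>P(a | c) P(b | ca) = P(ab | c)\<close>; both sides
  vanish if \<open>ca\<close> is impossible. As the right-hand side is linear in \<open>g\<close>, the formula holds on
  the whole space.\<close>

lemma observable_op_apply:
  assumes "g \<in> future_space M X"
  shows "observable_op M X L a g = (\<lambda>b. g (a # b))"
  using assms unfolding observable_op_def
proof (induction rule: future_space_induct)
  case (step r c g)
  have "future_fun M X c [a] * future_fun M X (c @ [a]) b = future_fun M X c (a # b)" for b
    using word_prob_append_eq_0[of "c @ [a]" b] by (simp add: future_fun_eq)
  with step show ?case
    by (simp only: future_extend_simps) (simp add: scaleR_fun_def)
qed (simp only: future_extend_simps(1), simp)

lemma future_norm_eq: "future_norm M X L g = sqrt (\<integral>s. future_embed M X L g s * future_embed M X L g s \<partial>law)"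
  by (simp add: future_norm_def future_inner_def future_measure_Nil)

lemma future_norm_nonneg: "0 \<le> future_norm M X L g"
  by (simp add: future_norm_eq)

text \<open>The density of the image of \<open>g\<close> is expressed in the chosen basis, and
  \<open>weight a s * f (a ## s)\<close> is another density with the same cylinder integrals; so they
  agree almost everywhere, and the contraction estimate applies.\<close>

lemma future_norm_observable_op_le:
  assumes g: "g \<in> future_space M X"
  shows "future_norm M X L (observable_op M X L a g) \<le> future_norm M X L g"
proof -
  let ?f = "future_embed M X L g" and ?f' = "future_embed M X L (observable_op M X L a g)"
  have f: "represents ?f g" and f': "represents ?f' (\<lambda>b. g (a # b))"
    using represents_future_embed[OF g] represents_future_embed[OF observable_op_in_future_space[OF g]]
    by (simp_all add: observable_op_apply[OF g])
  note [measurable] = f[THEN represents_measurable] f'[THEN represents_measurable]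
  have "AE s in law. ?f' s = weight a s * ?f (a ## s)"
    by (rule represents_unique[OF f' represents_SCons[OF f]])
  then have "(\<integral>s. ?f' s * ?f' s \<partial>law) = (\<integral>s. (weight a s * ?f (a ## s)) * (weight a s * ?f (a ## s)) \<partial>law)"
    by (intro integral_cong_AE) auto
  also have "\<dots> \<le> (\<integral>s. ?f s * ?f s \<partial>law)"
    by (rule integral_square_SCons_le[OF f])
  finally show ?thesis
    by (simp add: future_norm_eq)
qed

text \<open>Injectivity of the embedding: \<open>g\<close> is recovered from its density by integration over
  cylinders.\<close>

lemma future_norm_eq_0_iff:
  assumes g: "g \<in> future_space M X"
  shows "future_norm M X L g = 0 \<longleftrightarrow> g = 0"
proof
  let ?f = "future_embed M X L g"
  note f = represents_future_embed[OF g]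
  assume "future_norm M X L g = 0"
  then have "AE s in law. ?f s * ?f s = 0"
    by (subst integral_nonneg_eq_0_iff_AE[symmetric])
      (simp_all add: future_norm_eq represents_integrable[OF f])
  then have "(\<integral>s. indicator (cyl b) s * ?f s \<partial>law) = 0" for b
    by (intro integral_eq_zero_AE) auto
  then show "g = 0"
    using f by (simp add: represents_def fun_eq_iff)
next
  assume "g = 0"
  then show "future_norm M X L g = 0"
    by (simp add: future_norm_eq future_embed_def future_extend_simps)
qed

lemma future_norm_triangle:
  assumes "g \<in> future_space M X" "h \<in> future_space M X"
  shows "future_norm M X L (g + h) \<le> future_norm M X L g + future_norm M X L h"
proof -
  have "future_embed M X L (g + h) = future_embed M X L g + future_embed M X L h"
    by (simp add: future_embed_def linear_add[OF linear_future_extend])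
  then show ?thesis
    using assms[THEN represents_future_embed]
    by (simp add: future_norm_eq L2_triangle_ineq represents_integrable represents_measurable)
qed

lemma future_norm_minus_commute: "future_norm M X L (g - h) = future_norm M X L (h - g)"
  by (simp add: future_norm_eq future_embed_def linear_diff[OF linear_future_extend] algebra_simps)

lemma Metric_space_future_norm: "Metric_space (future_space M X) (\<lambda>g h. future_norm M X L (g - h))"
proof
  fix g h k
  show "0 \<le> future_norm M X L (g - h)"
    by (rule future_norm_nonneg)
  show "future_norm M X L (g - h) = future_norm M X L (h - g)"
    by (rule future_norm_minus_commute)
  assume *: "g \<in> future_space M X" "h \<in> future_space M X"
  then show "future_norm M X L (g - h) = 0 \<longleftrightarrow> g = h"
    by (subst future_norm_eq_0_iff) (auto simp: future_space_def intro: span_diff)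
  assume "k \<in> future_space M X"
  then show "future_norm M X L (g - k) \<le> future_norm M X L (g - h) + future_norm M X L (h - k)"
    using * future_norm_triangle[of "g - h" "h - k"] by (simp add: future_space_def span_diff)
qed

lemma continuous_map_observable_op:
  "continuous_map (future_topology M X L) (future_topology M X L) (observable_op M X L a)"
proof -
  interpret Metric_space "future_space M X" "\<lambda>g h. future_norm M X L (g - h)"
    by (rule Metric_space_future_norm)
  have "future_norm M X L (observable_op M X L a g - observable_op M X L a h) \<le> future_norm M X L (g - h)"
    if "g \<in> future_space M X" "h \<in> future_space M X" for g h
  proof -
    have "observable_op M X L a g - observable_op M X L a h = observable_op M X L a (g - h)"
      unfolding observable_op_def by (simp add: linear_diff[OF linear_future_extend])
    then show ?thesis
      using that future_norm_observable_op_le[of "g - h"] by (simp add: future_space_def span_diff)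
  qed
  then show ?thesis
    unfolding future_topology_def metric_continuous_map[OF Metric_space_future_norm]
    by (blast intro: observable_op_in_future_space le_less_trans)
qed

lemma onorm_on_observable_op: "onorm_on (future_space M X) (future_norm M X L) (observable_op M X L a) \<le> 1"
  unfolding onorm_on_def
proof (rule SUP_least)
  fix g assume "g \<in> future_space M X"
  from future_norm_observable_op_le[OF this, of a]
  show "ereal (future_norm M X L (observable_op M X L a g) / future_norm M X L g) \<le> 1"
    using future_norm_nonneg[of g]
    by (cases "future_norm M X L g = 0") (auto simp: divide_le_eq one_ereal_def)
qed

end

theorem theorem5p2:
  fixes M :: "'w measure" and X :: "int \<Rightarrow> 'w \<Rightarrow> 'o::countable" and L :: "'o list set"
  assumes "stationary_process M X"
    and "future_basis M X L"
    and "\<And>c. AE s in future_measure M X [].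
           convergent (\<lambda>k. future_fun M X c (stake k s) / future_fun M X [] (stake k s))"
  shows "\<forall>a. continuous_map (future_topology M X L) (future_topology M X L) (observable_op M X L a)
           \<and> onorm_on (future_space M X) (future_norm M X L) (observable_op M X L a) \<le> 1"
proof -
  interpret stationary_basis M X L
    by unfold_locales (rule assms)+
  show ?thesis
    using continuous_map_observable_op onorm_on_observable_op by blast
qed

end
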